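(* Let $D \subseteq \mathbb{R}$ be a set that is dense in some nonempty open interval of $\mathbb{R}$, let $\prec$ be an order on $D$ with order type $\omega$, and let $\mathcal{R} = (\mathbb{R},<,D,\prec)$. Then $\mathcal{R}$ defines $\mathcal{B}$.
   Context: $\mathcal{B}$ denotes the two-sorted first order structure $(\mathcal{P}(\mathbb{N}),\mathbb{N},\in,+1)$, where $\mathcal{P}(\mathbb{N})$ is the power set of $\mathbb{N}$, $\in$ is the membership relation between $\mathbb{N}$ and $\mathcal{P}(\mathbb{N})$, and $+1$ is the successor function on $\mathbb{N}$. "Definable" means first order definable with parameters. A structure with underlying set $\mathbb{R}$ "defines $\mathcal{B}$" if it defines an isomorphic copy of $\mathcal{B}$: there are definable sets $N', P'$ (subsets of Cartesian powers of $\mathbb{R}$), a definable relation $\epsilon \subseteq N' \times P'$ and a definable function $s: N' \to N'$ such that the two-sorted structure $(P',N',\epsilon,s)$ is isomorphic to $\mathcal{B}$. An order has order type $\omega$ if it is isomorphic to $(\mathbb{N},<)$. *)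

theory Defs
  imports "HOL-Analysis.Analysis"
begin

text \<open>First order formulas with equality over a relational language with symbols of type
  \<open>'r\<close>; variables are natural numbers.\<close>

datatype 'r fo_form =
    EqF nat nat
  | RelF 'r "nat list"
  | NegF "'r fo_form"
  | ConjF "'r fo_form" "'r fo_form"
  | ExF nat "'r fo_form"

text \<open>A structure whose underlying set is the type \<open>'a\<close> is given by the interpretation
  of its symbols. Arities are not part of the syntax: an interpretation is meant to return
  \<^const>\<open>False\<close> on argument lists of the wrong length.\<close>

type_synonym ('r, 'a) fo_struct = "'r \<Rightarrow> 'a list \<Rightarrow> bool"

primrec sat :: "('r, 'a) fo_struct \<Rightarrow> (nat \<Rightarrow> 'a) \<Rightarrow> 'r fo_form \<Rightarrow> bool" where
  "sat S v (EqF i j) \<longleftrightarrow> v i = v j"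
| "sat S v (RelF r is) \<longleftrightarrow> S r (map v is)"
| "sat S v (NegF \<phi>) \<longleftrightarrow> \<not> sat S v \<phi>"
| "sat S v (ConjF \<phi> \<psi>) \<longleftrightarrow> sat S v \<phi> \<and> sat S v \<psi>"
| "sat S v (ExF i \<phi>) \<longleftrightarrow> (\<exists>a. sat S (v(i := a)) \<phi>)"

text \<open>The \<open>n\<close>-th Cartesian power of \<open>'a\<close> is the set of lists of length \<open>n\<close>. The
  parameters are the values \<open>p i\<close>, \<open>i \<ge> n\<close>, only finitely many of which can matter for a
  given formula.\<close>

definition definable :: "('r, 'a) fo_struct \<Rightarrow> nat \<Rightarrow> 'a list set \<Rightarrow> bool" where
  "definable S n X \<longleftrightarrow>
     (\<exists>\<phi> p. X = {xs. length xs = n \<and> sat S (\<lambda>i. if i < n then xs ! i else p i) \<phi>})"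

record ('p, 'n) two_sorted =
  psort :: "'p set"
  nsort :: "'n set"
  mem :: "('n \<times> 'p) set"
  suc :: "'n \<Rightarrow> 'n"

text \<open>Values of \<^const>\<open>suc\<close> outside \<^const>\<open>nsort\<close> are irrelevant.\<close>

definition two_sorted_struct :: "('p, 'n) two_sorted \<Rightarrow> bool" where
  "two_sorted_struct M \<longleftrightarrow> mem M \<subseteq> nsort M \<times> psort M \<and> suc M \<in> nsort M \<rightarrow> nsort M"

definition two_sorted_isomorphic ::
    "('p, 'n) two_sorted \<Rightarrow> ('q, 'm) two_sorted \<Rightarrow> bool" where
  "two_sorted_isomorphic M M' \<longleftrightarrow>
     (\<exists>f g. bij_betw f (nsort M) (nsort M') \<and> bij_betw g (psort M) (psort M') \<and>
        (\<forall>x\<in>nsort M. \<forall>y\<in>psort M. (x, y) \<in> mem M \<longleftrightarrow> (f x, g y) \<in> mem M') \<and>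
        (\<forall>x\<in>nsort M. f (suc M x) = suc M' (f x)))"

definition struct_B :: "(nat set, nat) two_sorted" where
  "struct_B = \<lparr>psort = UNIV, nsort = UNIV, mem = {(n, A). n \<in> A}, suc = Suc\<rparr>"

definition defines_two_sorted ::
    "('r, 'a) fo_struct \<Rightarrow> ('q, 'm) two_sorted \<Rightarrow> bool" where
  "defines_two_sorted S B \<longleftrightarrow>
     (\<exists>m k (M :: ('a list, 'a list) two_sorted).
        two_sorted_struct M \<and>
        definable S m (nsort M) \<and>
        definable S k (psort M) \<and>
        definable S (m + k) {x @ y | x y. (x, y) \<in> mem M} \<and>
        definable S (m + m) {x @ suc M x | x. x \<in> nsort M} \<and>
        two_sorted_isomorphic M B)"

text \<open>\<open>r\<close> is read as a strict order on \<open>D\<close>, viewed as a set of pairs;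
  that it is a strict linear order follows from the isomorphism with \<open>(\<nat>, <)\<close>.\<close>

definition order_type_omega :: "'a set \<Rightarrow> ('a \<times> 'a) set \<Rightarrow> bool" where
  "order_type_omega D r \<longleftrightarrow>
     r \<subseteq> D \<times> D \<and>
     (\<exists>h :: 'a \<Rightarrow> nat. bij_betw h D UNIV \<and>
        (\<forall>x\<in>D. \<forall>y\<in>D. (x, y) \<in> r \<longleftrightarrow> h x < h y))"

definition dense_in_some_open_interval :: "real set \<Rightarrow> bool" where
  "dense_in_some_open_interval D \<longleftrightarrow>
     (\<exists>I. open I \<and> is_interval I \<and> I \<noteq> {} \<and> I \<subseteq> closure (D \<inter> I))"

datatype rsym = LessR | MemD | PrecR

fun real_struct :: "real set \<Rightarrow> (real \<times> real) set \<Rightarrow> (rsym, real) fo_struct" where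
  "real_struct D r LessR [x, y] \<longleftrightarrow> x < y"
| "real_struct D r MemD [x] \<longleftrightarrow> x \<in> D"
| "real_struct D r PrecR [x, y] \<longleftrightarrow> (x, y) \<in> r"
| "real_struct D r _ _ \<longleftrightarrow> False"

end

theory Submission
  imports Defs
begin

text \<open>
  Inside an interval in which \<open>D\<close> is dense, keep the part \<open>E = D \<inter> [c, b)\<close>, where \<open>c\<close> is the
  first point of \<open>D\<close> in the interval. For every \<open>d \<in> E\<close> the points of \<open>E\<close> that do not come after
  \<open>d\<close> form a finite set, the stage of \<open>d\<close>, and the stages cut \<open>[c, b)\<close> into finer and finer
  half-open gaps.

  The copy of \<open>\<nat>\<close>. For a real \<open>x\<close>, the left records of \<open>x\<close> are the points of \<open>E\<close> below \<open>x\<close> that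
  are nearer to \<open>x\<close> than all earlier points of \<open>E\<close> below \<open>x\<close>. They are definable from the
  parameter \<open>x\<close>, and the given order supplies the successor. A formula cannot run a recursion that
  picks a sparse sequence of points, but a single real \<open>x\<close> can record its outcome: having reached
  a record \<open>d\<close>, confine \<open>x\<close> to so short an interval to the right of \<open>d\<close> that the next record comes
  as late as desired. In this way the records \<open>e 0, e 1, \<dots>\<close> can be made so sparse that every gap of
  the stage of \<open>e k\<close> contains two points of the stage of \<open>e (Suc k)\<close>
  (\<open>ex_sparse_left_records\<close>).

  The copy of the power set. A real \<open>y \<in> [c, b)\<close> codes the set of all \<open>k\<close> such that, when passing
  from stage \<open>e k\<close> to stage \<open>e (Suc k)\<close>, a new point appears between \<open>y\<close> and the last older point
  at or below \<open>y\<close>. By sparsity the answer can be prescribed independently at every \<open>k\<close>: if \<open>u < v\<close>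
  are the first two new points in the current gap \<open>[l, r)\<close>, then \<open>[l, u)\<close> answers no and \<open>[u, v)\<close>
  answers yes. So every set has a code (\<open>ex_catches_eq\<close>). An isomorphism needs exactly one
  code for each set. Since each answer depends on finitely many half-open gaps, the codes of one set
  are closed under limits from above, and so they have a least element (\<open>ex_code\<close>). Being the
  least code of its set is a first order property of \<open>y\<close>.
\<close>

section \<open>A dense set enumerated in order type omega\<close>

lemma ex_least_value:
  fixes h :: "'a \<Rightarrow> nat"
  assumes "\<exists>u. P u"
  shows "\<exists>u. P u \<and> (\<forall>w. P w \<longrightarrow> h u \<le> h w)"
  using assms by (elim exE) (rule ex_has_least_nat)

text \<open>The order on \<open>E\<close> is represented by an injective rank \<open>h\<close>. The ranks may have gaps, so that the
  rank of a larger set can be used for each of its subsets.\<close>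

locale dense_enumeration =
  fixes E :: "real set" and h :: "real \<Rightarrow> nat" and c b :: real
  assumes inj: "inj_on h E"
    and c_in: "c \<in> E"
    and c_first: "u \<in> E \<Longrightarrow> h c \<le> h u"
    and lower: "u \<in> E \<Longrightarrow> c \<le> u"
    and upper: "u \<in> E \<Longrightarrow> u < b"
    and dense: "c \<le> l \<Longrightarrow> l < r \<Longrightarrow> r \<le> b \<Longrightarrow> \<exists>u\<in>E. l < u \<and> u < r"
begin

definition stage :: "nat \<Rightarrow> real set" where
  "stage n = {u \<in> E. h u \<le> n}"

definition left_records :: "real \<Rightarrow> real set" where
  "left_records x = {d \<in> E. d < x \<and> \<not> (\<exists>u\<in>E. h u < h d \<and> d < u \<and> u < x)}"

text \<open>A stage leaves room for a later one if each of its gaps receives two points: the first is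
  a free choice between going left and right of it, and the second separates the right-hand choice
  from the end of the gap.\<close>

definition roomy :: "nat \<Rightarrow> nat \<Rightarrow> bool" where
  "roomy n m \<longleftrightarrow> n < m \<and>
     (\<forall>l\<in>stage n. \<forall>r\<in>insert b (stage n). l < r \<longrightarrow>
        (\<exists>u\<in>stage m. \<exists>v\<in>stage m. l < u \<and> u < v \<and> v < r))"

text \<open>Read \<open>N\<close> as the copy of \<open>\<nat>\<close> and \<open>y\<close> as a code: the clause on \<open>n\<close> confines \<open>u\<close> to the stage of
  the successor of \<open>d\<close> in \<open>N\<close>, and the clause on \<open>v\<close> puts \<open>u\<close> beyond the last point at or below \<open>y\<close> of
  the stage of \<open>d\<close>. It is phrased with comparisons of ranks alone because a formula has to express
  it. The non-strict \<open>u \<le> y\<close> makes the gaps half-open, so that points of \<open>E\<close> are codes like all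
  other reals.\<close>

definition catches :: "real set \<Rightarrow> real \<Rightarrow> real \<Rightarrow> bool" where
  "catches N y d \<longleftrightarrow>
     (\<exists>u\<in>E. h d < h u \<and> \<not> (\<exists>n\<in>N. h d < h n \<and> h n < h u) \<and> u \<le> y \<and>
        \<not> (\<exists>v\<in>E. h v \<le> h d \<and> u < v \<and> v \<le> y))"

text \<open>One representative for each coded subset of \<open>N\<close>, namely the least.\<close>

definition codes :: "real set \<Rightarrow> real set" where
  "codes N = {y. c \<le> y \<and> y < b \<and>
     (\<forall>z. c \<le> z \<and> z < y \<longrightarrow> (\<exists>d\<in>N. catches N z d \<noteq> catches N y d))}"

lemma finite_stage: "finite (stage n)"
proof (rule inj_on_finite)
  show "inj_on h (stage n)" using inj by (auto simp: stage_def inj_on_def)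
  show "h ` stage n \<subseteq> {..n}" by (auto simp: stage_def)
qed simp

lemma stage_mono: "n \<le> m \<Longrightarrow> stage n \<subseteq> stage m"
  by (auto simp: stage_def)

lemma roomy_mono: "roomy n m \<Longrightarrow> m \<le> m' \<Longrightarrow> roomy n m'"
  unfolding roomy_def using stage_mono[of m m'] by (meson order_less_le_trans subsetD)

text \<open>There are only finitely many gaps, and density puts two points into each.\<close>

lemma ex_roomy: "\<exists>m. roomy n m"
proof -
  define I where "I = {(l, r). l \<in> stage n \<and> r \<in> insert b (stage n) \<and> l < r}"
  have "I \<subseteq> stage n \<times> insert b (stage n)" by (auto simp: I_def)
  then have fin: "finite I" by (rule finite_subset) (simp add: finite_stage)
  have "\<exists>u v. u \<in> E \<and> v \<in> E \<and> fst i < u \<and> u < v \<and> v < snd i" if "i \<in> I" for i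
  proof -
    have b: "c \<le> fst i" "fst i < snd i" "snd i \<le> b"
      using that lower upper by (auto simp: I_def stage_def less_imp_le)
    then obtain u where u: "u \<in> E" "fst i < u" "u < snd i" using dense by blast
    then obtain v where "v \<in> E" "u < v" "v < snd i" using dense[of u "snd i"] b lower by auto
    with u show ?thesis by blast
  qed
  then obtain U V where UV: "\<And>i. i \<in> I \<Longrightarrow> U i \<in> E \<and> V i \<in> E \<and> fst i < U i \<and> U i < V i \<and> V i < snd i"
    by metis
  define m where "m = Suc n + (\<Sum>i\<in>I. h (U i) + h (V i))"
  have "h (U i) \<le> m" "h (V i) \<le> m" if "i \<in> I" for i
    using member_le_sum[OF that, of "\<lambda>i. h (U i) + h (V i)"] fin by (auto simp: m_def)
  then have "\<exists>u\<in>stage m. \<exists>v\<in>stage m. fst i < u \<and> u < v \<and> v < snd i" if "i \<in> I" for i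
    using UV[OF that] that unfolding stage_def by blast
  then have "roomy n m" by (fastforce simp: roomy_def I_def m_def)
  then show ?thesis ..
qed

lemma gap_right:
  fixes e r :: real
  assumes "finite F" "e < r"
  obtains r' where "e < r'" "r' < r" "\<And>u. u \<in> F \<Longrightarrow> e < u \<Longrightarrow> r' < u"
proof -
  let ?F = "insert r (F \<inter> {e<..})"
  have fin: "finite ?F" using assms by simp
  have "e < Min ?F" using fin assms by auto
  then obtain r' where r': "e < r'" "r' < Min ?F" using Orderings.dense by blast
  have "r' < u" if "u \<in> ?F" for u using Min_le[OF fin that] r' by linarith
  then show thesis using that r' by auto
qed

text \<open>The recursion keeps a record \<open>e\<close> and an upper bound \<open>r\<close> for \<open>x\<close>. Given a stage \<open>m\<close> that
  the stage of \<open>e\<close> leaves room for, lower the bound to \<open>r'\<close> so that no point of stage \<open>m\<close> lies in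
  \<open>(e, r')\<close>. The next record is the earliest point of \<open>(e, r')\<close>, and it comes after stage \<open>m\<close>.\<close>

lemma ex_sparse_left_records:
  obtains x e where "e 0 = c" "range e = left_records x"
    "\<And>k. roomy (h (e k)) (h (e (Suc k)))"
proof -
  define P where "P = (\<lambda>(e, r). e \<in> E \<and> e < r \<and> r \<le> b)"
  define Q where "Q = (\<lambda>(e, r) (e', r'). r' < r \<and> e < e' \<and> e' < r' \<and> roomy (h e) (h e') \<and>
      (\<forall>u\<in>stage (h e). e < u \<longrightarrow> r' < u) \<and> (\<forall>u\<in>E. e < u \<and> u < r' \<longrightarrow> h e' \<le> h u))"
  have step: "\<exists>t. P t \<and> Q s t" if "P s" for s
  proof -
    obtain e r where s: "s = (e, r)" by (cases s)
    with that have er: "e \<in> E" "e < r" "r \<le> b" by (auto simp: P_def)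
    obtain m where m: "roomy (h e) m" using ex_roomy by blast
    obtain r' where r': "e < r'" "r' < r" "\<And>u. u \<in> stage m \<Longrightarrow> e < u \<Longrightarrow> r' < u"
      using gap_right[OF finite_stage er(2)] by metis
    have "\<exists>u. u \<in> E \<and> e < u \<and> u < r'" using dense[of e r'] lower er r' by auto
    then obtain e' where
      e': "e' \<in> E" "e < e'" "e' < r'" "\<And>u. u \<in> E \<Longrightarrow> e < u \<Longrightarrow> u < r' \<Longrightarrow> h e' \<le> h u"
      using ex_least_value[of "\<lambda>u. u \<in> E \<and> e < u \<and> u < r'" h] by blast
    have "m < h e'" using r'(3)[of e'] e' by (force simp: stage_def)
    then have "roomy (h e) (h e')" using roomy_mono m by simp
    moreover have "\<forall>u\<in>stage (h e). e < u \<longrightarrow> r' < u"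
      using r'(3) stage_mono[of "h e" m] m by (auto simp: roomy_def)
    ultimately have "P (e', r') \<and> Q s (e', r')" using e' r' er s by (auto simp: P_def Q_def)
    then show ?thesis ..
  qed
  have "P (c, b)" using c_in upper by (auto simp: P_def)
  then have "\<exists>s. \<forall>k. (P (s k) \<and> (k = 0 \<longrightarrow> s k = (c, b))) \<and> Q (s k) (s (Suc k))"
    by (intro dependent_nat_choice) (use step in auto)
  then obtain s where s: "\<And>k. P (s k)" "s 0 = (c, b)" "\<And>k. Q (s k) (s (Suc k))" by blast
  define e r where "e k = fst (s k)" and "r k = snd (s k)" for k
  have eE: "e k \<in> E" for k using s(1)[of k] by (auto simp: P_def e_def split: prod.splits)
  have Q: "r (Suc k) < r k" "e k < e (Suc k)" "e (Suc k) < r (Suc k)"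
      "roomy (h (e k)) (h (e (Suc k)))" "\<And>u. u \<in> stage (h (e k)) \<Longrightarrow> e k < u \<Longrightarrow> r (Suc k) < u"
      "\<And>u. u \<in> E \<Longrightarrow> e k < u \<Longrightarrow> u < r (Suc k) \<Longrightarrow> h (e (Suc k)) \<le> h u" for k
    using s(3)[of k] by (auto simp: Q_def e_def r_def split: prod.splits)
  have e_mono: "strict_mono e" using Q(2) by (rule strict_monoI_Suc)
  have r_mono: "decseq r" using Q(1) by (intro decseq_SucI less_imp_le)
  have er: "e j < r k" if "k > 0" for j k
  proof -
    have "e j \<le> e (max j k)" using e_mono by (simp add: strict_mono_less_eq)
    also have "\<dots> < r (max j k)" using Q(3)[of "max j k - 1"] that by simp
    also have "\<dots> \<le> r k" using r_mono by (simp add: decseqD)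
    finally show ?thesis .
  qed
  \<comment> \<open>The bounds decrease strictly, so the supremum stays below each of them.\<close>
  define x where "x = (SUP k. e k)"
  have bdd: "bdd_above (range e)" using er[of 1] by (auto intro!: bdd_aboveI[of _ "r 1"] less_imp_le)
  have xr: "x \<le> r (Suc k)" for k unfolding x_def by (rule cSUP_least) (auto intro: less_imp_le er)
  have ex: "e k < x" for k
    using Q(2)[of k] cSUP_upper[OF _ bdd, of "Suc k"] by (simp add: x_def)
  have "range e = left_records x"
  proof (intro set_eqI iffI)
    fix d assume "d \<in> range e"
    then obtain k where k: "d = e k" by blast
    have False if u: "u \<in> E" "h u < h d" "d < u" "u < x" for u
      using Q(5)[of u k] u k xr[of k] by (auto simp: stage_def)
    then show "d \<in> left_records x" using eE ex k by (auto simp: left_records_def)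
  next
    fix d assume d: "d \<in> left_records x"
    then have dE: "d \<in> E" "d < x" "\<And>u. u \<in> E \<Longrightarrow> d < u \<Longrightarrow> u < x \<Longrightarrow> h d \<le> h u"
      by (auto simp: left_records_def not_less[symmetric])
    obtain m where m: "d < e m" using dE(2) less_cSUP_iff[OF _ bdd] by (auto simp: x_def)
    \<comment> \<open>If \<open>d\<close> were strictly between two consecutive \<open>e j\<close> and \<open>e k\<close>, then \<open>e k\<close>, the earliest point
      there, would come before \<open>d\<close> and lie between \<open>d\<close> and \<open>x\<close>.\<close>
    define k where "k = (LEAST k. d < e k)"
    have k: "d < e k" unfolding k_def using m by (rule LeastI)
    have "k \<noteq> 0" using k lower[OF dE(1)] s(2) by (cases k) (auto simp: e_def)
    then obtain j where j: "k = Suc j" by (cases k) auto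
    have "e j \<le> d" using not_less_Least[of j "\<lambda>k. d < e k"] j by (simp add: k_def[symmetric])
    moreover have False if "e j < d"
    proof -
      have "h (e k) \<le> h d" using Q(6)[of d j] that dE j k Q(3)[of j] by simp
      moreover have "h d \<le> h (e k)" using dE(3)[OF eE k ex] .
      ultimately show False using inj eE[of k] dE(1) k by (auto dest: inj_onD)
    qed
    ultimately show "d \<in> range e" by force
  qed
  moreover have "e 0 = c" using s(2) by (simp add: e_def)
  ultimately show thesis using that Q(4) by blast
qed

end

section \<open>Coding sets of natural numbers along a sparse sequence\<close>

locale sparse_enumeration = dense_enumeration +
  fixes e :: "nat \<Rightarrow> real"
  assumes e_in: "e k \<in> E"
    and e_0: "e 0 = c"
    and e_roomy: "roomy (h (e k)) (h (e (Suc k)))"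
begin

lemma h_e_mono: "strict_mono (\<lambda>k. h (e k))"
  using e_roomy by (intro strict_monoI_Suc) (simp add: roomy_def)

lemma inj_e: "inj e"
  using strict_mono_imp_inj_on[OF h_e_mono, of UNIV] by (auto simp: inj_def)

text \<open>Whether \<open>y\<close> catches \<open>e k\<close> depends only on the position of \<open>y\<close> with respect to one finite
  stage.\<close>

lemma catches_e_iff:
  "catches (range e) y (e k) \<longleftrightarrow>
     (\<exists>u\<in>stage (h (e (Suc k))). h (e k) < h u \<and> u \<le> y \<and>
        \<not> (\<exists>v\<in>stage (h (e k)). u < v \<and> v \<le> y))"
proof -
  have "(\<exists>n\<in>range e. h (e k) < h n \<and> h n < h u) \<longleftrightarrow> h (e (Suc k)) < h u" for u
  proof
    assume "\<exists>n\<in>range e. h (e k) < h n \<and> h n < h u"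
    then obtain j where j: "h (e k) < h (e j)" "h (e j) < h u" by blast
    then have "Suc k \<le> j" using strict_mono_less[OF h_e_mono] by auto
    then have "h (e (Suc k)) \<le> h (e j)" using strict_mono_less_eq[OF h_e_mono] by auto
    with j show "h (e (Suc k)) < h u" by simp
  next
    assume "h (e (Suc k)) < h u"
    then show "\<exists>n\<in>range e. h (e k) < h n \<and> h n < h u"
      using e_roomy[of k] by (auto simp: roomy_def)
  qed
  then show ?thesis unfolding catches_def stage_def by (auto simp: not_less)
qed

lemma ex_two_first:
  assumes "l \<in> stage (h (e k))" "r \<in> insert b (stage (h (e k)))" "l < r"
  obtains u v where "u \<in> stage (h (e (Suc k)))" "v \<in> stage (h (e (Suc k)))"
    "l < u" "u < v" "v < r" "\<And>w. w \<in> stage (h (e (Suc k))) \<Longrightarrow> l < w \<Longrightarrow> u \<le> w"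
    "\<And>w. w \<in> stage (h (e (Suc k))) \<Longrightarrow> u < w \<Longrightarrow> v \<le> w"
proof -
  let ?S = "stage (h (e (Suc k)))"
  obtain u0 v0 where 0: "u0 \<in> ?S" "v0 \<in> ?S" "l < u0" "u0 < v0" "v0 < r"
    using e_roomy[of k] assms by (meson roomy_def)
  define u where "u = Min (?S \<inter> {l<..})"
  have "u \<in> ?S \<inter> {l<..}" unfolding u_def using 0 finite_stage by (intro Min_in) auto
  moreover have u: "u \<le> w" if "w \<in> ?S" "l < w" for w
    unfolding u_def using that finite_stage by (intro Min_le) auto
  moreover define v where "v = Min (?S \<inter> {u<..})"
  moreover have uv0: "u < v0" using u[of u0] 0 by simp
  then have "v \<in> ?S \<inter> {u<..}" unfolding v_def using 0 finite_stage by (intro Min_in) auto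
  moreover have v: "v \<le> w" if "w \<in> ?S" "u < w" for w
    unfolding v_def using that finite_stage by (intro Min_le) auto
  moreover have "v < r" using v[OF 0(2) uv0] 0 by simp
  ultimately show thesis using that by blast
qed

text \<open>Nested gaps \<open>[l, r)\<close> of the stages of \<open>e k\<close> are chosen so that all their points give the
  prescribed answers below \<open>k\<close>. The right ends decrease strictly, since both \<open>u\<close> and \<open>v\<close> lie below \<open>r\<close>;
  hence the supremum of the left ends belongs to all the half-open gaps.\<close>

lemma ex_catches_eq: "\<exists>y. c \<le> y \<and> y < b \<and> (\<forall>k. catches (range e) y (e k) \<longleftrightarrow> k \<in> A)"
proof -
  let ?S = "\<lambda>k. stage (h (e k))"
  define P where "P k = (\<lambda>(l, r). l \<in> ?S k \<and> r \<in> insert b (?S k) \<and> l < r \<and>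
      (\<forall>w\<in>?S k. l < w \<longrightarrow> r \<le> w))" for k
  define Q where "Q k = (\<lambda>(l, r) (l', r'). l \<le> l' \<and> r' < r \<and>
      (if k \<in> A then l' \<in> ?S (Suc k) \<and> l < l' else (\<forall>w\<in>?S (Suc k). l < w \<longrightarrow> r' \<le> w)))" for k
  have step: "\<exists>t. P (Suc k) t \<and> Q k s t" if "P k s" for k s
  proof -
    obtain l r where s: "s = (l, r)" by (cases s)
    with that have lr: "l \<in> ?S k" "r \<in> insert b (?S k)" "l < r" by (auto simp: P_def)
    have lS: "l \<in> ?S (Suc k)" using lr stage_mono[of "h (e k)" "h (e (Suc k))"] e_roomy[of k]
      by (auto simp: roomy_def)
    obtain u v where uv: "u \<in> ?S (Suc k)" "v \<in> ?S (Suc k)"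
      "l < u" "u < v" "v < r" "\<And>w. w \<in> ?S (Suc k) \<Longrightarrow> l < w \<Longrightarrow> u \<le> w"
      "\<And>w. w \<in> ?S (Suc k) \<Longrightarrow> u < w \<Longrightarrow> v \<le> w"
      by (rule ex_two_first[OF lr]) blast
    show ?thesis
    proof (cases "k \<in> A")
      case True
      then have "P (Suc k) (u, v) \<and> Q k s (u, v)" using uv s by (auto simp: P_def Q_def)
      then show ?thesis ..
    next
      case False
      then have "P (Suc k) (l, u) \<and> Q k s (l, u)" using uv s lS by (auto simp: P_def Q_def)
      then show ?thesis ..
    qed
  qed
  \<comment> \<open>The first stage is \<open>{c}\<close>, so \<open>[c, b)\<close> is its only gap.\<close>
  have "w = c" if "w \<in> ?S 0" for w
    using that inj c_in c_first[of w] by (auto simp: stage_def e_0 inj_on_def)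
  then have "P 0 (c, b)" using c_in upper e_0 by (auto simp: P_def stage_def)
  then have "\<exists>s. \<forall>k. P k (s k) \<and> Q k (s k) (s (Suc k))"
    by (intro dependent_nat_choice) (use step in auto)
  then obtain s where s: "\<And>k. P k (s k)" "\<And>k. Q k (s k) (s (Suc k))" by blast
  define l r where "l k = fst (s k)" and "r k = snd (s k)" for k
  have P: "l k \<in> ?S k" "r k \<in> insert b (?S k)" "l k < r k"
      "\<And>w. w \<in> ?S k \<Longrightarrow> l k < w \<Longrightarrow> r k \<le> w" for k
    using s(1)[of k] by (auto simp: P_def l_def r_def split: prod.splits)
  have Q: "l k \<le> l (Suc k)" "r (Suc k) < r k"
      "k \<in> A \<Longrightarrow> l (Suc k) \<in> ?S (Suc k) \<and> l k < l (Suc k)"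
      "\<And>w. k \<notin> A \<Longrightarrow> w \<in> ?S (Suc k) \<Longrightarrow> l k < w \<Longrightarrow> r (Suc k) \<le> w" for k
    using s(2)[of k] by (auto simp: Q_def l_def r_def split: prod.splits if_splits)
  have l_mono: "incseq l" using Q(1) by (rule incseq_SucI)
  have r_mono: "decseq r" using Q(2) by (intro decseq_SucI less_imp_le)
  have lr: "l j < r k" for j k
  proof -
    have "l j \<le> l (max j k)" using l_mono by (simp add: incseqD)
    also have "\<dots> < r (max j k)" using P(3) .
    also have "\<dots> \<le> r k" using r_mono by (simp add: decseqD)
    finally show ?thesis .
  qed
  define y where "y = (SUP k. l k)"
  have bdd: "bdd_above (range l)" by (auto intro!: bdd_aboveI[of _ "r 0"] less_imp_le lr)
  have ly: "l k \<le> y" for k unfolding y_def using bdd by (intro cSUP_upper) auto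
  have "y \<le> r k" for k unfolding y_def by (rule cSUP_least) (auto intro: less_imp_le lr)
  then have yr: "y < r k" for k using Q(2)[of k] order_le_less_trans by blast
  have "catches (range e) y (e k) \<longleftrightarrow> k \<in> A" for k
  proof
    assume k: "k \<in> A"
    show "catches (range e) y (e k)" unfolding catches_e_iff
    proof (intro bexI conjI notI)
      show "l (Suc k) \<in> ?S (Suc k)" "l (Suc k) \<le> y" using Q(3)[OF k] ly by auto
      show "h (e k) < h (l (Suc k))"
        using P(4)[of "l (Suc k)" k] Q(3)[OF k] lr[of "Suc k" k] by (force simp: stage_def)
      assume "\<exists>v\<in>?S k. l (Suc k) < v \<and> v \<le> y"
      then show False using P(4)[of _ k] Q(1)[of k] yr[of k] by force
    qed
  next
    assume "catches (range e) y (e k)"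
    then obtain u where u: "u \<in> ?S (Suc k)" "h (e k) < h u" "u \<le> y"
      "\<And>v. v \<in> ?S k \<Longrightarrow> u < v \<Longrightarrow> \<not> v \<le> y" by (auto simp: catches_e_iff)
    have "l k \<noteq> u" using P(1)[of k] u(2) by (auto simp: stage_def)
    then have "l k < u" using u(4)[OF P(1)] ly[of k] by force
    then show "k \<in> A" using Q(4)[of k u] u(1,3) yr[of "Suc k"] by force
  qed
  moreover have "c \<le> y" using P(1)[of 0] ly[of 0] lower by (force simp: stage_def)
  moreover have "y < b" using P(2)[of 0] yr[of 0] upper by (force simp: stage_def)
  ultimately show ?thesis by blast
qed

text \<open>The infimum \<open>z\<close> of all codes of \<open>A\<close> is again a code of \<open>A\<close>: for fixed \<open>k\<close>, no point of the stage
  that decides about \<open>k\<close> lies in some interval \<open>(z, t]\<close>, and this interval or \<open>z\<close> itself provides a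
  code of \<open>A\<close>, which then gives the same answer as \<open>z\<close>.\<close>

lemma ex_code: "\<exists>y\<in>codes (range e). \<forall>k. catches (range e) y (e k) \<longleftrightarrow> k \<in> A"
proof -
  define C where "C = {y. c \<le> y \<and> y < b \<and> (\<forall>k. catches (range e) y (e k) \<longleftrightarrow> k \<in> A)}"
  have ne: "C \<noteq> {}" using ex_catches_eq by (auto simp: C_def)
  have bdd: "bdd_below C" by (auto simp: C_def intro: bdd_belowI[of _ c])
  define z where "z = Inf C"
  have zC: "z \<le> y" if "y \<in> C" for y unfolding z_def using bdd that by (rule cInf_lower[rotated])
  have "c \<le> z" unfolding z_def using ne by (rule cInf_greatest) (auto simp: C_def)
  moreover have "z < b" using ne zC by (force simp: C_def)
  moreover have "catches (range e) z (e k) \<longleftrightarrow> k \<in> A" for k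
  proof -
    obtain t where t: "z < t" "\<And>u. u \<in> stage (h (e (Suc k))) \<Longrightarrow> z < u \<Longrightarrow> t < u"
      using gap_right[OF finite_stage, of z "z + 1"] by (metis less_add_one)
    obtain y where y: "y \<in> C" "y < t" using t(1) cInf_less_iff[OF ne bdd] by (auto simp: z_def)
    have S: "u \<le> z \<longleftrightarrow> u \<le> y" if "u \<in> stage (h (e (Suc k)))" for u
      using t(2)[OF that] zC[OF y(1)] y(2) by force
    moreover have "stage (h (e k)) \<subseteq> stage (h (e (Suc k)))"
      using e_roomy[of k] by (intro stage_mono) (simp add: roomy_def)
    ultimately have "catches (range e) z (e k) \<longleftrightarrow> catches (range e) y (e k)"
      unfolding catches_e_iff by (smt (verit, best) subsetD)
    then show ?thesis using y(1) by (simp add: C_def)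
  qed
  ultimately have z: "z \<in> C" by (simp add: C_def)
  have "\<exists>d\<in>range e. catches (range e) w d \<noteq> catches (range e) z d" if "c \<le> w" "w < z" for w
  proof -
    have "w \<notin> C" "w < b" using zC that \<open>z < b\<close> by force+
    then show ?thesis using z that by (auto simp: C_def)
  qed
  then have "z \<in> codes (range e)" using z by (auto simp: codes_def C_def)
  then show ?thesis using z by (auto simp: C_def)
qed

lemma bij_betw_codes:
  "bij_betw (\<lambda>y. {k. catches (range e) y (e k)}) (codes (range e)) UNIV"
  unfolding bij_betw_def
proof
  show "inj_on (\<lambda>y. {k. catches (range e) y (e k)}) (codes (range e))"
  proof (rule inj_onI)
    fix y z
    assume y: "y \<in> codes (range e)" and z: "z \<in> codes (range e)"
      and eq: "{k. catches (range e) y (e k)} = {k. catches (range e) z (e k)}"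
    have "catches (range e) y d = catches (range e) z d" if "d \<in> range e" for d
      using that eq by auto
    then have "\<not> y < z" "\<not> z < y" using y z by (auto simp: codes_def)
    then show "y = z" by simp
  qed
  have "A \<in> (\<lambda>y. {k. catches (range e) y (e k)}) ` codes (range e)" for A
    using ex_code[of A] by (force intro: rev_image_eqI)
  then show "(\<lambda>y. {k. catches (range e) y (e k)}) ` codes (range e) = UNIV" by blast
qed

end

text \<open>Starting the interval at its earliest point makes the first stage a singleton.\<close>

lemma ex_dense_enumeration:
  assumes "dense_in_some_open_interval D" "inj_on h D"
  obtains c b where "dense_enumeration {d \<in> D. c \<le> d \<and> d < b} h c b"
proof -
  obtain I where I: "open I" "is_interval I" "I \<noteq> {}" "I \<subseteq> closure (D \<inter> I)"
    using assms(1) by (auto simp: dense_in_some_open_interval_def)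
  obtain p where "p \<in> I" using I(3) by blast
  then obtain \<epsilon> where \<epsilon>: "\<epsilon> > 0" "ball p \<epsilon> \<subseteq> I" using I(1) openE by blast
  define b where "b = p + \<epsilon>"
  have sub: "t \<in> I" if "p < t" "t < b" for t
    using \<epsilon> that by (auto simp: b_def dist_real_def subset_iff)
  have dn: "\<exists>u\<in>D. l < u \<and> u < r" if lr: "p \<le> l" "l < r" "r \<le> b" for l r
  proof -
    have "(l + r) / 2 \<in> {l<..<r} \<inter> closure (D \<inter> I)" using lr I(4) sub[of "(l + r) / 2"] by auto
    then have "{l<..<r} \<inter> (D \<inter> I) \<noteq> {}"
      using open_Int_closure_eq_empty[OF open_greaterThanLessThan] by blast
    then show ?thesis by auto
  qed
  have "\<exists>u. u \<in> D \<and> p < u \<and> u < b" using dn[of p b] \<epsilon> by (auto simp: b_def)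
  then obtain c where
    c: "c \<in> D" "p < c" "c < b" "\<And>u. u \<in> D \<Longrightarrow> p < u \<Longrightarrow> u < b \<Longrightarrow> h c \<le> h u"
    using ex_least_value[of "\<lambda>u. u \<in> D \<and> p < u \<and> u < b" h] by blast
  have "dense_enumeration {d \<in> D. c \<le> d \<and> d < b} h c b"
  proof
    show "inj_on h {d \<in> D. c \<le> d \<and> d < b}" using assms(2) by (auto simp: inj_on_def)
    fix l r assume "c \<le> l" "l < r" "r \<le> b"
    then show "\<exists>u\<in>{d \<in> D. c \<le> d \<and> d < b}. l < u \<and> u < r" using dn[of l r] c(2) by force
  qed (use c in auto)
  then show thesis using that by blast
qed

section \<open>Defining formulas\<close>

abbreviation "LessF i j \<equiv> RelF LessR [i, j]"
abbreviation "PrecF i j \<equiv> RelF PrecR [i, j]"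
abbreviation "DisjF \<phi> \<psi> \<equiv> NegF (ConjF (NegF \<phi>) (NegF \<psi>))"
abbreviation "XorF \<phi> \<psi> \<equiv> DisjF (ConjF \<phi> (NegF \<psi>)) (ConjF (NegF \<phi>) \<psi>)"

text \<open>Variables 0 and 1 are the arguments, and the values of 2, 3 and 4 are the parameters \<open>b\<close>, \<open>c\<close> and
  \<open>x\<close>. The variables from 5 on are bound; each quantifier that has another one in its scope uses its
  own index, which avoids capture.\<close>

definition pointF :: "nat \<Rightarrow> rsym fo_form" where
  "pointF i = ConjF (RelF MemD [i]) (ConjF (NegF (LessF i 3)) (LessF i 2))"

definition recordF :: "nat \<Rightarrow> rsym fo_form" where
  "recordF i = ConjF (pointF i) (ConjF (LessF i 4)
     (NegF (ExF 5 (ConjF (pointF 5) (ConjF (PrecF 5 i) (ConjF (LessF i 5) (LessF 5 4)))))))"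

definition catchesF :: "nat \<Rightarrow> nat \<Rightarrow> rsym fo_form" where
  "catchesF y d = ExF 6 (ConjF (pointF 6) (ConjF (PrecF d 6) (ConjF
     (NegF (ExF 7 (ConjF (recordF 7) (ConjF (PrecF d 7) (PrecF 7 6))))) (ConjF
     (NegF (LessF y 6))
     (NegF (ExF 8 (ConjF (pointF 8) (ConjF (NegF (PrecF d 8))
       (ConjF (LessF 6 8) (NegF (LessF y 8)))))))))))"

definition codeF :: "nat \<Rightarrow> rsym fo_form" where
  "codeF y = ConjF (NegF (LessF y 3)) (ConjF (LessF y 2)
     (NegF (ExF 9 (ConjF (NegF (LessF 9 3)) (ConjF (LessF 9 y)
       (NegF (ExF 10 (ConjF (recordF 10) (XorF (catchesF 9 10) (catchesF y 10))))))))))"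

definition nextF :: "rsym fo_form" where
  "nextF = ConjF (recordF 0) (ConjF (recordF 1) (ConjF (PrecF 0 1)
     (NegF (ExF 11 (ConjF (recordF 11) (ConjF (PrecF 0 11) (PrecF 11 1)))))))"

lemma definable_unaryI:
  assumes "\<And>a. sat S (p(0 := a)) \<phi> \<longleftrightarrow> Q a"
  shows "definable S 1 {[a] | a. Q a}"
  unfolding definable_def
proof (intro exI set_eqI)
  fix xs
  have "(\<lambda>i. if i < 1 then [a] ! i else p i) = p(0 := a)" for a by auto
  then show "xs \<in> {[a] | a. Q a} \<longleftrightarrow>
      xs \<in> {xs. length xs = 1 \<and> sat S (\<lambda>i. if i < 1 then xs ! i else p i) \<phi>}"
    using assms by (auto simp: length_Suc_conv)
qed

lemma definable_binaryI:
  assumes "\<And>a b. sat S (p(0 := a, 1 := b)) \<phi> \<longleftrightarrow> Q a b"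
  shows "definable S (1 + 1) {[a, b] | a b. Q a b}"
  unfolding definable_def
proof (intro exI set_eqI)
  fix xs
  have "(\<lambda>i. if i < 1 + 1 then [a, b] ! i else p i) = p(0 := a, 1 := b)" for a b
    by (auto simp: less_Suc_eq)
  then show "xs \<in> {[a, b] | a b. Q a b} \<longleftrightarrow>
      xs \<in> {xs. length xs = 1 + 1 \<and> sat S (\<lambda>i. if i < 1 + 1 then xs ! i else p i) \<phi>}"
    using assms by (auto simp: length_Suc_conv)
qed

section \<open>The definable copy\<close>

text \<open>\<open>E\<close> is the part of \<open>D\<close> between two parameters and the ranks are compared by \<open>prec\<close>; hence all
  notions above become expressible.\<close>

locale represented_enumeration = sparse_enumeration +
  fixes D :: "real set" and prec :: "(real \<times> real) set" and x :: real
  assumes E: "E = {d \<in> D. c \<le> d \<and> d < b}"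
    and prec: "u \<in> E \<Longrightarrow> w \<in> E \<Longrightarrow> (u, w) \<in> prec \<longleftrightarrow> h u < h w"
    and range_e: "range e = left_records x"
begin

lemma sat_pointF:
  "v 2 = b \<Longrightarrow> v 3 = c \<Longrightarrow> sat (real_struct D prec) v (pointF i) \<longleftrightarrow> v i \<in> E"
  by (auto simp: pointF_def E)

lemma sat_recordF:
  assumes "v 2 = b" "v 3 = c" "v 4 = x" "i \<noteq> 5"
  shows "sat (real_struct D prec) v (recordF i) \<longleftrightarrow> v i \<in> left_records x"
  using assms by (auto simp: recordF_def left_records_def sat_pointF prec)

lemma sat_catchesF:
  assumes "v 2 = b" "v 3 = c" "v 4 = x" "y \<notin> {6, 7, 8}" "d \<notin> {6, 7, 8}"
    and "v d \<in> left_records x"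
  shows "sat (real_struct D prec) v (catchesF y d) \<longleftrightarrow> catches (left_records x) (v y) (v d)"
proof -
  have r: "u \<in> E" if "u \<in> left_records x" for u using that by (auto simp: left_records_def)
  show ?thesis
    using assms by (auto simp: catchesF_def catches_def sat_pointF sat_recordF prec r not_less
        cong: conj_cong)
qed

lemma sat_codeF:
  assumes "v 2 = b" "v 3 = c" "v 4 = x" "y \<notin> {6, 7, 8, 9, 10}"
  shows "sat (real_struct D prec) v (codeF y) \<longleftrightarrow> v y \<in> codes (left_records x)"
  using assms by (auto simp: codeF_def codes_def sat_recordF sat_catchesF not_less cong: conj_cong)

text \<open>In the copy, \<open>k\<close> is represented by \<open>e k\<close> and a set of numbers by its least code, each as a list
  of length one. The successor is definable because the ranks of the \<open>e k\<close> increase with \<open>k\<close>.\<close>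

lemma defines_struct_B: "defines_two_sorted (real_struct D prec) struct_B"
proof -
  define p :: "nat \<Rightarrow> real" where "p i = (if i = 2 then b else if i = 3 then c else x)" for i
  let ?S = "real_struct D prec"
  define N where "N = left_records x"
  have N: "range e = N" "left_records x = N" by (simp_all add: N_def range_e)
  have N_in: "u \<in> E" if "u \<in> N" for u using that by (auto simp: N_def left_records_def)
  note sat = sat_recordF sat_catchesF sat_codeF
  define M :: "(real list, real list) two_sorted" where
    "M = \<lparr>psort = {[y] | y. y \<in> codes N}, nsort = {[d] | d. d \<in> N},
      mem = {([d], [y]) | d y. d \<in> N \<and> y \<in> codes N \<and> catches N y d},
      suc = (\<lambda>ds. [e (Suc (inv e (hd ds)))])\<rparr>"
  have suc_e: "suc M [e k] = [e (Suc k)]" for k by (simp add: M_def inj_e inv_f_f)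
  have nsort: "nsort M = range (\<lambda>k. [e k])" using N by (auto simp: M_def)
  have "two_sorted_struct M" using N by (auto simp: two_sorted_struct_def M_def)
  moreover have "definable ?S 1 (nsort M)"
    unfolding M_def two_sorted.simps
    by (rule definable_unaryI[where p = p and \<phi> = "recordF 0"]) (simp add: sat N p_def)
  moreover have "definable ?S 1 (psort M)"
    unfolding M_def two_sorted.simps
    by (rule definable_unaryI[where p = p and \<phi> = "codeF 0"]) (simp add: sat N p_def)
  moreover have "{x @ y | x y. (x, y) \<in> mem M} =
      {[d, y] | d y. d \<in> N \<and> y \<in> codes N \<and> catches N y d}" (is "?L = ?R")
  proof
    show "?L \<subseteq> ?R" by (auto simp: M_def)
    show "?R \<subseteq> ?L"
    proof
      fix zs assume "zs \<in> ?R"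
      then obtain d y where "zs = [d] @ [y]" "([d], [y]) \<in> mem M" by (auto simp: M_def)
      then show "zs \<in> ?L" by blast
    qed
  qed
  then have "definable ?S (1 + 1) {x @ y | x y. (x, y) \<in> mem M}"
    by (simp only:) (rule definable_binaryI[where p = p
      and \<phi> = "ConjF (recordF 0) (ConjF (codeF 1) (catchesF 1 0))"],
      auto simp: sat N p_def)
  moreover have "{x @ suc M x | x. x \<in> nsort M} =
      {[d, d'] | d d'. d \<in> N \<and> d' \<in> N \<and> h d < h d' \<and> \<not> (\<exists>n\<in>N. h d < h n \<and> h n < h d')}"
      (is "?L = ?R")
  proof -
    have next_iff: "(h (e i) < h (e j) \<and> \<not> (\<exists>n\<in>N. h (e i) < h n \<and> h n < h (e j))) \<longleftrightarrow> j = Suc i" for i j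
    proof -
      have "(\<exists>n\<in>N. h (e i) < h n \<and> h n < h (e j)) \<longleftrightarrow> (\<exists>k. i < k \<and> k < j)"
        using strict_mono_less[OF h_e_mono] N(1) by auto
      then show ?thesis using strict_mono_less[OF h_e_mono] by (auto intro: Suc_lessI)
    qed
    show ?thesis
    proof
      show "?L \<subseteq> ?R" using next_iff N(1) by (auto simp: nsort suc_e)
      show "?R \<subseteq> ?L"
      proof
        fix zs assume "zs \<in> ?R"
        then obtain i j where "zs = [e i, e j]" "j = Suc i" using next_iff N(1) by blast
        then have "zs = [e i] @ suc M [e i]" "[e i] \<in> nsort M" by (auto simp: nsort suc_e)
        then show "zs \<in> ?L" by blast
      qed
    qed
  qed
  then have "definable ?S (1 + 1) {x @ suc M x | x. x \<in> nsort M}"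
    by (simp only:) (rule definable_binaryI[where p = p and \<phi> = nextF],
      auto simp: nextF_def sat N N_in p_def prec cong: conj_cong)
  moreover have "two_sorted_isomorphic M struct_B"
    unfolding two_sorted_isomorphic_def
  proof (intro exI conjI)
    show "bij_betw (\<lambda>ds. inv e (hd ds)) (nsort M) (nsort struct_B)"
      by (rule bij_betw_byWitness[where f' = "\<lambda>k. [e k]"])
        (auto simp: nsort struct_B_def inj_e inv_f_f)
    have "bij_betw hd (psort M) (codes N)"
      by (rule bij_betw_byWitness[where f' = "\<lambda>y. [y]"]) (auto simp: M_def)
    from bij_betw_trans[OF this bij_betw_codes[unfolded N]]
    show "bij_betw ((\<lambda>y. {k. catches N y (e k)}) \<circ> hd) (psort M) (psort struct_B)"
      by (simp add: struct_B_def)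
    show "\<forall>ds\<in>nsort M. \<forall>ys\<in>psort M. (ds, ys) \<in> mem M \<longleftrightarrow>
        (inv e (hd ds), ((\<lambda>y. {k. catches N y (e k)}) \<circ> hd) ys) \<in> mem struct_B"
      using N(1) by (auto simp: M_def struct_B_def inj_e inv_f_f)
    show "\<forall>ds\<in>nsort M. inv e (hd (suc M ds)) = suc struct_B (inv e (hd ds))"
      by (auto simp: nsort suc_e struct_B_def inj_e inv_f_f)
  qed
  ultimately show ?thesis unfolding defines_two_sorted_def by blast
qed

end

theorem theoremA:
  fixes D :: "real set" and prec :: "(real \<times> real) set"
  assumes "dense_in_some_open_interval D"
    and "order_type_omega D prec"
  shows "defines_two_sorted (real_struct D prec) struct_B"
proof -
  have "\<exists>h :: real \<Rightarrow> nat. bij_betw h D UNIV \<and>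
      (\<forall>u\<in>D. \<forall>w\<in>D. (u, w) \<in> prec \<longleftrightarrow> h u < h w)"
    using assms(2) unfolding order_type_omega_def by (rule conjunct2)
  then obtain h :: "real \<Rightarrow> nat" where "bij_betw h D UNIV \<and>
      (\<forall>u\<in>D. \<forall>w\<in>D. (u, w) \<in> prec \<longleftrightarrow> h u < h w)" ..
  note h = conjunct1[OF this] conjunct2[OF this]
  obtain c b where "dense_enumeration {d \<in> D. c \<le> d \<and> d < b} h c b"
    using ex_dense_enumeration[OF assms(1) bij_betw_imp_inj_on[OF h(1)]] .
  then interpret dense_enumeration "{d \<in> D. c \<le> d \<and> d < b}" h c b .
  obtain x e where e: "e 0 = c" "range e = left_records x" "\<And>k. roomy (h (e k)) (h (e (Suc k)))"
    by (rule ex_sparse_left_records) (rule that)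
  interpret represented_enumeration "{d \<in> D. c \<le> d \<and> d < b}" h c b e D prec x
  proof
    fix k
    have "e k \<in> left_records x" using e(2) by blast
    then show "e k \<in> {d \<in> D. c \<le> d \<and> d < b}" by (simp add: left_records_def)
  qed (use e h(2) in auto)
  show ?thesis by (rule defines_struct_B)
qed

end
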